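(* Let $A\in\mathbb{C}^{n\times n}$, $D\in\mathbb{C}^{m\times m}$, $B\in\mathbb{C}^{m\times n}$, $C\in\mathbb{C}^{n\times m}$, and put $S=A-CD^{d}B$, $H=BA^{d}$, $K=A^{d}C$, $\Gamma=HK$, $k=\operatorname{ind}(A)$. If $A^{\pi}CD^{d}B=0$, $K\Gamma^{d}HSA^{d}=0$ and $K\Gamma^{\pi}D^{d}H=0$, then $$S^{d}=(I-K\Gamma^{d}H)A^{d}(I-K\Gamma^{d}H)-\sum_{i=0}^{k-1}\bigl((I-K\Gamma^{d}H)A^{d}\bigr)^{i+2}K\Gamma^{d}HSA^{i}-\sum_{i=0}^{k-1}\bigl((I-K\Gamma^{d}H)A^{d}\bigr)^{i+1}K\Gamma^{\pi}D^{d}BA^{i}.$$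
   Context: For a square complex matrix $X$, $\operatorname{ind}(X)$ is the smallest non-negative integer $k$ with $\operatorname{rank}(X^{k})=\operatorname{rank}(X^{k+1})$, and the Drazin inverse $X^{d}$ is the unique matrix with $XX^{d}=X^{d}X$, $X^{d}XX^{d}=X^{d}$, $X^{k}=X^{k+1}X^{d}$ for $k=\operatorname{ind}(X)$. Write $X^{\pi}=I-XX^{d}$. Conventions: $X^{0}=I$ for every square matrix $X$, and $\sum_{i=0}^{k}\ast=0$ if $k<0$. *)

theory Defs
  imports "HOL-Analysis.Analysis"
begin

text \<open>On the type of matrices the library operations \<open>*\<close> and \<open>^\<close> are not the matrix product and
  matrix power (\<open>*\<close> is componentwise), so powers with respect to \<open>**\<close> are introduced here.\<close>

primrec matpow :: "complex^'n^'n \<Rightarrow> nat \<Rightarrow> complex^'n^'n" where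
  "matpow X 0 = mat 1"
| "matpow X (Suc i) = X ** matpow X i"

definition ind :: "complex^'n^'n \<Rightarrow> nat" where
  "ind X = (LEAST k. rank (matpow X k) = rank (matpow X (k + 1)))"

definition is_drazin_inverse :: "complex^'n^'n \<Rightarrow> complex^'n^'n \<Rightarrow> bool" where
  "is_drazin_inverse X Y \<longleftrightarrow>
     X ** Y = Y ** X \<and>
     Y ** X ** Y = Y \<and>
     matpow X (ind X) = matpow X (ind X + 1) ** Y"

definition drazin :: "complex^'n^'n \<Rightarrow> complex^'n^'n" where
  "drazin X = (THE Y. is_drazin_inverse X Y)"

definition spectral_idem :: "complex^'n^'n \<Rightarrow> complex^'n^'n" where
  \<comment> \<open>the matrix written \<open>X\<close> with superscript \<open>\<pi>\<close>\<close>
  "spectral_idem X = mat 1 - X ** drazin X"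

end

theory Submission
  imports Defs
begin

text \<open>Put \<open>a = A\<^sup>d\<close>, \<open>P = A a\<close>, \<open>E = K \<Gamma>\<^sup>d H\<close>, \<open>F = 1 - E\<close>, \<open>R = K D\<^sup>d B\<close> and \<open>G = R a\<close>.
  The hypotheses say that \<open>S = A - A R\<close> with \<open>P R = R\<close>, that \<open>E A G = E\<close> for the idempotent \<open>E\<close>, and
  that \<open>F G = 0\<close>. So \<open>G\<close> inverts \<open>E A E\<close> from the right in the corner ring of \<open>E\<close>; in finite dimension
  it is a two-sided inverse, and \<open>G E = G\<close>. With respect to the decomposition given by \<open>P\<close>, the matrix
  \<open>S\<close> is block triangular: its first diagonal block \<open>S P = A P - A G A\<close> has group inverse
  \<open>X = F a F\<close>, and its second one is the nilpotent part of \<open>A\<close>. Hence the Drazin inverse of \<open>S\<close> is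
  \<open>X + (\<Sum>i<k. X\<^sup>i\<^sup>+\<^sup>2 S (1 - P) A\<^sup>i)\<close>, and splitting \<open>F S (1 - P) = S (1 - P) - E S\<close> in each term gives
  the two sums of the statement.\<close>

section \<open>Matrix algebra\<close>

lemma matrix_sub_ldistrib: "A ** (B - C) = A ** B - A ** C"
  for A :: "'a::ring_1^'n^'m"
  by (vector matrix_matrix_mult_def sum_subtractf right_diff_distrib)

lemma matrix_sub_rdistrib: "(A - B) ** C = A ** C - B ** C"
  for A :: "'a::ring_1^'n^'m"
  by (vector matrix_matrix_mult_def sum_subtractf left_diff_distrib)

lemma matrix_minus_right: "A ** (- B) = - (A ** B)"
  for A :: "'a::ring_1^'n^'m"
  using matrix_sub_ldistrib[of A 0 B] by simp

lemma matrix_minus_left: "(- A) ** B = - (A ** B)"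
  for A :: "'a::ring_1^'n^'m"
  using matrix_sub_rdistrib[of 0 A B] by simp

lemma matrix_add_rdistrib: "(A + B) ** C = A ** C + B ** C"
  for A :: "'a::semiring_1^'n^'m"
  by (vector matrix_matrix_mult_def sum.distrib distrib_right)

lemma matrix_sum_ldistrib: "A ** (\<Sum>i\<in>I. f i) = (\<Sum>i\<in>I. A ** f i)"
  for A :: "'a::ring_1^'n^'m"
  by (induction I rule: infinite_finite_induct) (simp_all add: matrix_add_ldistrib)

lemma matrix_sum_rdistrib: "(\<Sum>i\<in>I. f i) ** A = (\<Sum>i\<in>I. f i ** A)"
  for A :: "'a::ring_1^'n^'m"
  by (induction I rule: infinite_finite_induct) (simp_all add: matrix_add_rdistrib)

lemmas matrix_distribs = matrix_add_ldistrib matrix_add_rdistrib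
  matrix_sub_ldistrib matrix_sub_rdistrib matrix_minus_left matrix_minus_right

text \<open>Lets an equation for a product of two factors also rewrite the head of a longer
  right-associated product.\<close>

lemma matrix_mul_prefix: "X ** Y = Z \<Longrightarrow> X ** (Y ** W) = Z ** W"
  by (simp add: matrix_mul_assoc)

lemma matpow_add: "matpow X (i + j) = matpow X i ** matpow X j"
  by (induction i) (simp_all add: matrix_mul_assoc)

lemma matpow_Suc_right: "matpow X (Suc i) = matpow X i ** X"
  using matpow_add[of X i 1] by simp

text \<open>Each substitution of the identity into itself adds one \<open>L\<close> on the left and
  one \<open>X\<close> on the right.\<close>

lemma matpow_sandwich:
  assumes "L ** M ** X = M"
  shows "matpow L j ** M ** matpow X j = M"
proof (induction j)
  case (Suc j)
  have "matpow L (Suc j) ** M ** matpow X (Suc j)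
      = L ** (matpow L j ** M ** matpow X j) ** X"
    by (simp add: matpow_Suc_right[of X] matrix_mul_assoc del: matpow.simps(2))
      (simp add: matrix_mul_assoc)
  then show ?case using Suc assms by simp
qed simp

section \<open>Factorizations from comparing ranges and row spaces\<close>

lemma matrix_factor_right:
  fixes M :: "'a::comm_ring_1^'n^'m" and N :: "'a^'p^'m"
  assumes "\<And>x. \<exists>z. M *v x = N *v z"
  obtains Z where "M = N ** Z"
proof -
  obtain z where z: "\<And>j. M *v axis j 1 = N *v z j"
    using that choice[of "\<lambda>j z. M *v axis j 1 = N *v z"] assms by blast
  have "M $ i $ j = (N ** (\<chi> i j. z j $ i)) $ i $ j" for i j
  proof -
    have "M $ i $ j = (M *v axis j 1) $ i"
      by (simp add: matrix_vector_mult_def axis_def if_distrib cong: if_cong)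
    also have "\<dots> = (N *v z j) $ i" using z by simp
    finally show ?thesis
      by (simp add: matrix_vector_mult_def matrix_matrix_mult_def)
  qed
  then have "M = N ** (\<chi> i j. z j $ i)" by (simp add: vec_eq_iff)
  then show ?thesis using that by blast
qed

lemma rows_mult_subset: "rows (A ** B) \<subseteq> range (\<lambda>w. w v* B)"
proof -
  have "row i (A ** B) = row i A v* B" for i
    by (simp add: row_def vec_eq_iff matrix_matrix_mult_def vector_matrix_mult_def mult.commute)
  then show ?thesis by (auto simp: rows_def)
qed

lemma span_rows: "vec.span (rows B) = range (\<lambda>w. w v* B)"
  for B :: "'a::field^'n^'m"
proof
  have "vec.subspace (range (\<lambda>w. w v* B))"
  proof (unfold vec.subspace_def, intro conjI ballI allI)
    show "0 \<in> range (\<lambda>w. w v* B)"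
      by (metis rangeI vector_matrix_mult_0)
    show "x + y \<in> range (\<lambda>w. w v* B)"
      if "x \<in> range (\<lambda>w. w v* B)" "y \<in> range (\<lambda>w. w v* B)" for x y
      using that by (auto simp flip: vector_matrix_left_distrib)
    show "c *s x \<in> range (\<lambda>w. w v* B)" if x: "x \<in> range (\<lambda>w. w v* B)" for c x
    proof -
      obtain w where "x = w v* B" using x by auto
      then have "c *s x = (c *s w) v* B"
        by (simp add: vec_eq_iff vector_matrix_mult_def sum_distrib_left ac_simps)
      then show ?thesis by blast
    qed
  qed
  moreover have "rows B \<subseteq> range (\<lambda>w. w v* B)"
    using rows_mult_subset[of "mat 1" B] by simp
  ultimately show "vec.span (rows B) \<subseteq> range (\<lambda>w. w v* B)"
    by (rule vec.span_minimal[rotated])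
  show "range (\<lambda>w. w v* B) \<subseteq> vec.span (rows B)"
  proof
    fix y assume "y \<in> range (\<lambda>w. w v* B)"
    then obtain w where "y = w v* B" by auto
    also have "\<dots> = (\<Sum>i\<in>UNIV. w $ i *s row i B)"
      by (simp add: vec_eq_iff vector_matrix_mult_def row_def mult.commute)
    also have "\<dots> \<in> vec.span (rows B)"
      by (intro vec.span_sum vec.span_scale vec.span_base) (auto simp: rows_def)
    finally show "y \<in> vec.span (rows B)" .
  qed
qed

lemma rank_mult_le_right: "rank (A ** B) \<le> rank B"
  for B :: "'a::field^'n^'m"
proof -
  have "rows (A ** B) \<subseteq> vec.span (rows B)"
    using rows_mult_subset by (auto simp: span_rows)
  then have "vec.dim (rows (A ** B)) \<le> vec.dim (vec.span (rows B))"
    by (rule vec.dim_subset)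
  then show ?thesis by (simp add: row_rank_def_gen)
qed

text \<open>The row space of \<open>A ** B\<close> lies in that of \<open>B\<close>, and equal
  dimensions force equality. The coefficients that express the rows of \<open>B\<close> through
  those of \<open>A ** B\<close> form the rows of \<open>W\<close>.\<close>

lemma rank_mult_eqD:
  fixes A :: "'a::field^'n^'m" and B :: "'a^'p^'n"
  assumes "rank (A ** B) = rank B"
  obtains W where "B = W ** (A ** B)"
proof -
  have eq: "vec.span (rows (A ** B)) = vec.span (rows B)"
  proof (rule vec.subspace_dim_equal)
    show "vec.span (rows (A ** B)) \<subseteq> vec.span (rows B)"
      using rows_mult_subset[of A B]
      by (intro vec.span_minimal vec.subspace_span) (simp add: span_rows)
  qed (use assms in \<open>simp_all add: row_rank_def_gen\<close>)
  have "row i B \<in> range (\<lambda>w. w v* (A ** B))" for i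
    unfolding span_rows[symmetric] eq by (rule vec.span_base) (auto simp: rows_def)
  then have "\<exists>w. row i B = w v* (A ** B)" for i by blast
  then obtain w where w: "\<And>i. row i B = w i v* (A ** B)"
    using choice[of "\<lambda>i w. row i B = w v* (A ** B)"] by blast
  have "B $ i $ j = ((\<chi> i. w i) ** (A ** B)) $ i $ j" for i j
  proof -
    have "B $ i $ j = row i B $ j" by (simp add: row_def)
    then show ?thesis unfolding w
      by (simp add: vector_matrix_mult_def matrix_matrix_mult_def[of _ "A ** B"] mult.commute)
  qed
  then have "B = (\<chi> i. w i) ** (A ** B)" by (simp add: vec_eq_iff)
  then show ?thesis using that by blast
qed

text \<open>\<^term>\<open>Q\<close> maps its range injectively, hence onto, to itself.\<close>
lemma square_factor_right:
  fixes Q :: "'a::field^'n^'n"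
  assumes V: "Q = V ** (Q ** Q)"
  obtains Z where "Q = Q ** Q ** Z"
proof -
  let ?R = "range ((*v) Q)"
  have sub: "vec.subspace ?R"
    by (metis vec.subspace_UNIV vec.subspace_image matrix_vector_mul_linear_gen)
  have *: "V *v (Q *v y) = y" if "y \<in> ?R" for y
    using that by (auto simp: matrix_vector_mul_assoc V[symmetric] matrix_mul_assoc[symmetric])
  have "inj_on ((*v) Q) (vec.span ?R)"
    using sub * by (metis inj_onI vec.span_eq_iff)
  then have "vec.dim ((*v) Q ` ?R) = vec.dim ?R"
    by (intro vec.dim_image_eq) auto
  then have "(*v) Q ` ?R = ?R"
    using sub by (intro vec.subspace_dim_equal) (auto intro!: vec.subspace_image)
  then have "\<exists>z. Q *v x = (Q ** Q) *v z" for x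
    by (metis (no_types, lifting) imageE matrix_vector_mul_assoc rangeI)
  then show ?thesis using matrix_factor_right that by metis
qed

section \<open>The Drazin inverse\<close>

lemma ind_factor_left: obtains W where "W ** matpow X (ind X) ** X = matpow X (ind X)"
proof -
  have "\<exists>k. rank (matpow X k) = rank (matpow X (k + 1))"
  proof (rule ccontr)
    assume neg: "\<not> ?thesis"
    \<comment> \<open>If consecutive ranks never agreed, every step would lower the rank by at least
      one, which cannot go on forever. Hence the \<open>LEAST\<close> in \<open>ind_def\<close> is
      attained.\<close>
    have "rank (matpow X k) + k \<le> rank (matpow X 0)" for k
    proof (induction k)
      case (Suc k)
      have "rank (matpow X (Suc k)) \<le> rank (matpow X k)"
        by (simp add: rank_mult_le_right)
      with neg have "rank (matpow X (Suc k)) < rank (matpow X k)"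
        by (metis Suc_eq_plus1 le_neq_implies_less)
      with Suc show ?case by linarith
    qed simp
    from this[of "Suc (rank (matpow X 0))"] show False by simp
  qed
  then have "rank (matpow X (ind X)) = rank (matpow X (ind X + 1))"
    unfolding ind_def by (rule LeastI_ex)
  then have "rank (X ** matpow X (ind X)) = rank (matpow X (ind X))" by simp
  then obtain W where "matpow X (ind X) = W ** (X ** matpow X (ind X))"
    by (rule rank_mult_eqD)
  then show ?thesis
    using that by (metis matpow.simps(2) matpow_Suc_right matrix_mul_assoc)
qed

text \<open>The hypotheses give \<open>Y ** Y ** X = Y\<close> and \<open>X ** Y ** Y = Y\<close>;
  \<open>matpow_sandwich\<close> iterates both.\<close>

lemma outer_inverse_powers:
  assumes "X ** Y = Y ** X" "Y ** X ** Y = Y"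
  shows "matpow Y (Suc l) ** matpow X l = Y" "matpow X l ** matpow Y (Suc l) = Y"
proof -
  have "Y ** Y ** X = Y" "X ** Y ** Y = Y"
    using assms by (metis matrix_mul_assoc)+
  note this[THEN matpow_sandwich, of l]
  then show "matpow Y (Suc l) ** matpow X l = Y" "matpow X l ** matpow Y (Suc l) = Y"
    by (metis matpow_Suc_right, metis matpow.simps(2) matrix_mul_assoc)
qed

text \<open>Both candidates equal \<open>Y ** X ** Z\<close>. Expanding \<open>Y\<close> as Y^(l+1)
  X^l makes X^l absorb \<open>X ** Z\<close>; expanding \<open>Z\<close> as X^l Z^(l+1) makes X^l
  absorb \<open>Y ** X\<close>.\<close>

lemma drazin_inverse_unique:
  assumes "X ** Y = Y ** X" "Y ** X ** Y = Y" "matpow X l = matpow X (l + 1) ** Y"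
    and "X ** Z = Z ** X" "Z ** X ** Z = Z" "matpow X l = matpow X (l + 1) ** Z"
  shows "Y = Z"
proof -
  have "Y ** X ** Z = matpow Y (Suc l) ** (matpow X l ** X ** Z)"
    using outer_inverse_powers(1)[OF assms(1,2), of l] by (metis matrix_mul_assoc)
  also have "\<dots> = Y"
    using assms(6) outer_inverse_powers(1)[OF assms(1,2), of l]
    by (simp add: matpow_Suc_right del: matpow.simps(2))
  finally have 1: "Y ** X ** Z = Y" .
  have comm: "Y ** matpow X j = matpow X j ** Y" for j
    by (induction j) (auto simp: matrix_mul_assoc assms(1)[symmetric], simp add: matrix_mul_assoc[symmetric])
  have "Y ** X ** Z = (Y ** matpow X (Suc l)) ** matpow Z (Suc l)"
    using outer_inverse_powers(2)[OF assms(4,5), of l] by (metis matpow.simps(2) matrix_mul_assoc)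
  also have "\<dots> = matpow X l ** matpow Z (Suc l)"
    using assms(3) comm by (metis Suc_eq_plus1)
  also have "\<dots> = Z" by (rule outer_inverse_powers(2)[OF assms(4,5)])
  finally show ?thesis using 1 by simp
qed

lemma is_drazin_inverseD:
  assumes "is_drazin_inverse X Y"
  shows "X ** Y = Y ** X" "Y ** X ** Y = Y" "matpow X (ind X) = matpow X (ind X + 1) ** Y"
  using assms unfolding is_drazin_inverse_def by - (elim conjE; assumption)+

text \<open>The power condition may be checked at any exponent \<open>j\<close>, below or above the
  index: \<open>matpow X (ind X)\<close> has \<open>matpow X j\<close> as a right factor, so the
  condition carries over to it.\<close>

lemma drazin_eqI:
  assumes "X ** Y = Y ** X" "Y ** X ** Y = Y" "matpow X j ** X ** Y = matpow X j"
  shows "drazin X = Y" "is_drazin_inverse X Y"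
proof -
  obtain W where W: "W ** matpow X (ind X) ** X = matpow X (ind X)"
    by (rule ind_factor_left)
  have *: "matpow W j ** matpow X (ind X) ** matpow X j = matpow X (ind X)"
    by (rule matpow_sandwich[OF W])
  have "matpow X (ind X) ** X ** Y
      = matpow W j ** matpow X (ind X) ** (matpow X j ** X ** Y)"
    using * by (metis matrix_mul_assoc)
  also have "\<dots> = matpow X (ind X)"
    by (simp only: assms(3) *)
  finally have "matpow X (ind X) = matpow X (ind X + 1) ** Y"
    by (simp only: matpow_Suc_right Suc_eq_plus1[symmetric])
  with assms(1,2) show Y: "is_drazin_inverse X Y"
    unfolding is_drazin_inverse_def by (intro conjI)
  show "drazin X = Y"
    unfolding drazin_def
  proof (rule the_equality[where P = "is_drazin_inverse X", OF Y])
    fix Z assume "is_drazin_inverse X Z"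
    from is_drazin_inverseD[OF this] is_drazin_inverseD[OF Y] show "Z = Y"
      by (rule drazin_inverse_unique)
  qed
qed

text \<open>Existence, without which the description in \<open>drazin_def\<close> carries no
  information. The inverse is built from a left factor \<open>W\<close> and a right factor
  \<open>Z\<close> that each undo one factor \<open>X\<close> on the stable power
  \<open>Q\<close>.\<close>

lemma is_drazin_inverse_drazin: "is_drazin_inverse X (drazin X)"
proof -
  let ?l = "ind X"
  obtain W where W: "W ** matpow X ?l ** X = matpow X ?l"
    by (rule ind_factor_left)
  have "matpow X ?l = matpow W ?l ** (matpow X ?l ** matpow X ?l)"
    using matpow_sandwich[OF W, of ?l] by (simp add: matrix_mul_assoc)
  then obtain Z' where Z': "matpow X ?l = matpow X ?l ** matpow X ?l ** Z'"
    by (rule square_factor_right)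
  \<comment> \<open>Only one of the extra factors \<open>X\<close> in
    \<open>matpow X ?l ** matpow X ?l\<close> should remain, so the other \<open>m\<close> move into
    \<open>Z\<close>. At index 0 there is none to keep, but then \<open>X\<close> is
    invertible.\<close>
  then obtain Z where Z: "X ** matpow X ?l ** Z = matpow X ?l"
  proof (cases ?l)
    case 0
    then have "W ** X = mat 1" using W by simp
    then have "X ** W = mat 1" by (rule matrix_left_right_inverse[THEN iffD1])
    with 0 show ?thesis using that[of W] by simp
  next
    case (Suc m)
    have "matpow X (?l + ?l) = X ** matpow X ?l ** matpow X m"
      using matpow_add[of X "Suc ?l" m] Suc by simp
    then have "X ** matpow X ?l ** (matpow X m ** Z') = matpow X ?l"
      using Z' by (metis matpow_add matrix_mul_assoc)
    then show ?thesis by (rule that)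
  qed
  define Q where "Q = matpow X ?l"
  have W': "W ** Q ** X = Q" and Z': "X ** Q ** Z = Q" and XQ: "X ** Q = Q ** X"
    using W Z matpow_Suc_right[of X ?l] by (simp_all add: Q_def)
  have "Q ** Z = W ** Q ** X ** Z" by (simp add: W')
  also have "\<dots> = W ** Q"
    by (metis Z' XQ matrix_mul_assoc)
  finally have QZ: "Q ** Z = W ** Q" .
  have QZj: "Q ** matpow Z j = matpow W j ** Q" for j
  proof (induction j)
    case (Suc j)
    then show ?case by (metis QZ matpow.simps(2) matpow_Suc_right matrix_mul_assoc)
  qed simp
  \<comment> \<open>On \<open>Q\<close>, right multiplication by \<open>Z\<close> acts as division
    by \<open>X\<close>, so this stands for X^l times X^(-l-1). By \<open>QZj\<close> it can also be
    written with powers of \<open>W\<close> on the left, which gives commutation.\<close>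
  define Y where "Y = Q ** matpow Z (Suc ?l)"
  have XY: "X ** Y = Q ** matpow Z ?l"
    using Z' by (simp add: Y_def matrix_mul_assoc)
  have "Y ** X = matpow W (Suc ?l) ** Q ** X"
    by (simp only: Y_def QZj)
  also have "\<dots> = matpow W ?l ** (W ** Q ** X)"
    by (simp only: matpow_Suc_right matrix_mul_assoc)
  finally have YX: "Y ** X = matpow W ?l ** Q" by (simp only: W')
  have "X ** Y = Y ** X" by (simp only: XY YX QZj)
  moreover have "matpow W ?l ** Q ** Q = Q"
    using matpow_sandwich[OF W', of ?l] by (simp add: Q_def)
  then have "Y ** X ** Y = Y"
    unfolding YX by (simp add: Y_def matrix_mul_assoc del: matpow.simps(2))
  moreover have "matpow X ?l ** X ** Y = matpow X ?l"
    using matpow_sandwich[OF Z', of ?l] XY by (metis Q_def matrix_mul_assoc)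
  ultimately show ?thesis
    using drazin_eqI[of X Y ?l] by metis
qed

lemma drazin_commute: "X ** drazin X = drazin X ** X"
  and drazin_outer: "drazin X ** X ** drazin X = drazin X"
  and matpow_ind_drazin: "matpow X (ind X) ** X ** drazin X = matpow X (ind X)"
proof -
  note D = is_drazin_inverseD[OF is_drazin_inverse_drazin[of X]]
  show "X ** drazin X = drazin X ** X" by (rule D)
  show "drazin X ** X ** drazin X = drazin X" by (rule D)
  show "matpow X (ind X) ** X ** drazin X = matpow X (ind X)"
    unfolding matpow_Suc_right[symmetric] by (metis D(3) Suc_eq_plus1)
qed

section \<open>Perturbations by an idempotent\<close>

text \<open>Here (1-P) S P = 0, the last three hypotheses make \<open>X\<close> the group inverse of
  the block \<open>S ** P\<close>, and \<open>A\<close> is nilpotent on the complementary block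
  because A^k (1-P) = 0. The sum is the off-diagonal block of the Drazin inverse; the nilpotency
  makes it finite.\<close>

lemma drazin_block_triangular:
  assumes AP: "A ** P = P ** A" and PP: "P ** P = P" and Ak: "matpow A k ** P = matpow A k"
    and SA: "(mat 1 - P) ** S = (mat 1 - P) ** A"
    and PX: "P ** X = X" and XP: "X ** P = X"
    and XSP: "X ** S ** P = S ** X" and XSX: "X ** S ** X = X" and SXSP: "S ** X ** S ** P = S ** P"
  shows "drazin S = X + (\<Sum>i<k. matpow X (i + 2) ** S ** (mat 1 - P) ** matpow A i)"
proof -
  define \<pi> where "\<pi> = mat 1 - P"
  define U where "U = (\<Sum>i<k. matpow X (i + 2) ** S ** \<pi> ** matpow A i)"
  define W where "W = (\<Sum>i<k. matpow X (i + 1) ** S ** \<pi> ** matpow A i)"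
  note assoc = matrix_mul_assoc[symmetric]
  have [simp]: "\<pi> ** P = 0" "P ** \<pi> = 0" "\<pi> ** X = 0" "\<pi> ** \<pi> = \<pi>"
    using PP PX by (simp_all add: \<pi>_def matrix_distribs)
  have A\<pi>: "A ** \<pi> = \<pi> ** A"
    using AP by (simp add: \<pi>_def matrix_distribs)
  have Ai\<pi>: "matpow A i ** \<pi> = \<pi> ** matpow A i" for i
  proof (induction i)
    case (Suc i)
    then show ?case using A\<pi> by simp (metis matrix_mul_assoc)
  qed simp
  have \<pi>Ak: "\<pi> ** matpow A k = 0"
    using Ak by (simp add: Ai\<pi>[symmetric]) (simp add: \<pi>_def matrix_distribs)
  have \<pi>S: "\<pi> ** S = \<pi> ** A" using SA by (simp add: \<pi>_def)
  have \<pi>Sj: "\<pi> ** matpow S j = \<pi> ** matpow A j" for j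
  proof (induction j)
    case (Suc j)
    have "\<pi> ** matpow S (Suc j) = A ** (\<pi> ** matpow S j)"
      using \<pi>S A\<pi> by (simp add: matrix_mul_assoc)
    also have "\<dots> = \<pi> ** matpow A (Suc j)"
      using A\<pi> by (simp add: Suc matrix_mul_assoc)
    finally show ?case .
  qed simp
  have SXX: "S ** X ** X = X"
    by (metis PX XSP XSX matrix_mul_assoc)
  have PQ: "P ** (S ** X) = S ** X"
    by (metis PX XSP matrix_mul_assoc)
  have Sp: "S ** matpow X (i + 2) = matpow X (i + 1)" for i
    using SXX by (simp add: matrix_mul_assoc)
  have SU: "S ** U = W"
    by (simp only: U_def W_def matrix_sum_ldistrib matrix_mul_assoc Sp)
  have XW: "X ** W = U"
    by (simp add: U_def W_def matrix_sum_ldistrib matrix_mul_assoc)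
  have U\<pi>: "U ** \<pi> = U"
    by (simp add: U_def matrix_sum_rdistrib assoc Ai\<pi>) (simp add: matrix_mul_assoc)
  have UP: "U ** P = 0"
    by (metis U\<pi> \<open>\<pi> ** P = 0\<close> matrix_mul_assoc times0_right)
  have PW: "P ** W = W"
    using PX by (simp add: W_def matrix_sum_ldistrib matrix_mul_assoc)
  have US: "U ** S = U ** A"
    by (metis U\<pi> \<pi>S matrix_mul_assoc)
  \<comment> \<open>Right multiplication by \<open>A\<close> shifts the summation index by one. The
    added term supplies the case i = 0, and the surplus term i = k vanishes by
    \<open>\<pi>Ak\<close>. This is what makes \<open>T\<close> commute with
    \<open>S\<close>.\<close>
  have "X ** S ** \<pi> + U ** A = (\<Sum>i<Suc k. matpow X (i + 1) ** S ** \<pi> ** matpow A i)"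
    unfolding sum.lessThan_Suc_shift
    by (simp add: U_def matrix_sum_rdistrib assoc matpow_Suc_right[symmetric] del: matpow.simps(2))
      (simp add: matrix_mul_assoc)
  also have "\<dots> = W"
    using \<pi>Ak by (simp add: W_def assoc)
  finally have UA: "X ** S ** \<pi> + U ** A = W" .
  define T where "T = X + U"
  have ST: "S ** T = S ** X + W"
    by (simp add: T_def matrix_distribs SU)
  have "X ** S = S ** X + X ** S ** \<pi>"
    by (simp add: \<pi>_def matrix_distribs XSP)
  then have "T ** S = S ** X + X ** S ** \<pi> + U ** A"
    by (simp only: T_def matrix_add_rdistrib US)
  then have TS: "T ** S = S ** X + W"
    by (simp only: UA add.assoc)
  have UQ: "U ** (S ** X) = 0"
    by (metis PQ UP matrix_mul_assoc times0_left)
  have UW: "U ** W = 0"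
    by (metis PW UP matrix_mul_assoc times0_left)
  have TST: "T ** S ** T = T"
    using XSX unfolding assoc ST by (simp add: T_def matrix_distribs UQ UW XW assoc)
  have eX: "T ** S ** X = X"
    using XSX UQ by (simp add: T_def matrix_distribs assoc)
  have eSP: "T ** S ** (S ** P) = S ** P"
    by (metis SXSP XSP eX matrix_mul_assoc)
  \<comment> \<open>The power k + 1 leaves one \<open>S\<close> in front after \<pi> S^k = 0 has
    removed the nilpotent part. The result has the left factor \<open>S ** P\<close>, on which
    \<open>T ** S\<close> acts as the identity.\<close>
  have "matpow S (k + 1) = S ** P ** matpow S k + S ** (\<pi> ** matpow S k)"
    by (simp add: \<pi>_def matrix_distribs matrix_mul_assoc)
  then have Sk: "matpow S (k + 1) = S ** P ** matpow S k"
    by (simp only: \<pi>Sj \<pi>Ak) simp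
  have comm: "S ** T = T ** S" using ST TS by simp
  have "matpow S (k + 1) ** S ** T = S ** T ** matpow S (k + 1)"
  proof -
    have "matpow S j ** (S ** T) = S ** T ** matpow S j" for j
    proof (induction j)
      case (Suc j)
      have "matpow S (Suc j) ** (S ** T) = S ** (S ** T ** matpow S j)"
        by (simp add: Suc[symmetric] matrix_mul_assoc)
      then show ?case by (simp add: comm) (simp add: comm matrix_mul_assoc)
    qed simp
    then show ?thesis by (simp only: matrix_mul_assoc)
  qed
  also have "\<dots> = T ** S ** (S ** P) ** matpow S k"
    by (simp only: comm Sk matrix_mul_assoc)
  also have "\<dots> = matpow S (k + 1)"
    by (simp only: eSP Sk)
  finally have "drazin S = T"
    by (rule drazin_eqI(1)[OF comm TST])
  then show ?thesis by (simp add: T_def U_def \<pi>_def)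
qed

text \<open>In the corner ring of the idempotent \<open>E\<close>, the element \<open>G ** E\<close> is a right inverse of \<open>E ** A ** E\<close>,
  hence also a left inverse because matrices are Dedekind-finite.\<close>
lemma corner_inverse:
  fixes E :: "'a::field^'n^'n"
  assumes EE: "E ** E = E" and EG: "E ** G = G" and EAG: "E ** A ** G = E"
  shows "G ** E = G" "G ** A ** E = E"
proof -
  define F where "F = mat 1 - E"
  have F: "E ** F = 0" "F ** E = 0" "F ** F = F" "F ** G = 0"
    using EE EG by (simp_all add: F_def matrix_distribs)
  have "E ** (A ** (G ** E)) = E"
    by (simp add: matrix_mul_assoc EAG EE)
  note r = this EE EG EAG[unfolded matrix_mul_assoc[symmetric]] F
  note r' = r r[THEN matrix_mul_prefix]
  \<comment> \<open>Adding the complementary idempotent \<open>F\<close> turns inverses in the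
    corner into inverses of full matrices, where a one-sided inverse is two-sided.\<close>
  have "(E ** A ** E + F) ** (G ** E + F) = E + F"
    by (simp add: matrix_distribs matrix_mul_assoc[symmetric] r')
  also have "\<dots> = mat 1" by (simp add: F_def)
  finally have "(G ** E + F) ** (E ** A ** E + F) = mat 1"
    by (rule matrix_left_right_inverse[THEN iffD1])
  then have "G ** E ** A ** E + F = mat 1"
    by (simp add: matrix_distribs matrix_mul_assoc[symmetric] r')
  then have GEAE: "G ** E ** A ** E = E" by (simp add: F_def)
  have "G = G ** E ** A ** E ** G"
    by (simp add: GEAE EG)
  also have "\<dots> = G ** E"
    by (simp add: matrix_mul_assoc[symmetric] r')
  finally show "G ** E = G" by simp
  then show "G ** A ** E = E" using GEAE by simp
qed

text \<open>Adjacent factors \<open>F\<close> merge. The exponent starts at 1, since at 0 the two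
  sides would be \<open>mat 1\<close> and \<open>F\<close>.\<close>

lemma matpow_mult_idem:
  assumes "F ** F = F"
  shows "matpow (F ** a ** F) (Suc j) = matpow (F ** a) (Suc j) ** F"
proof (induction j)
  case (Suc j)
  then show ?case
    using assms by (simp add: matrix_mul_assoc) (metis matrix_mul_assoc)
qed simp

text \<open>The theorem expressed through \<open>E\<close> and \<open>R\<close> alone, obtained from
  \<open>drazin_block_triangular\<close> with P = A a and X = F a F.\<close>

lemma drazin_idem_perturbation:
  fixes A :: "complex^'n^'n"
  defines "a \<equiv> drazin A"
  assumes EE: "E ** E = E" and AaE: "A ** a ** E = E" and EAa: "E ** A ** a = E"
    and AaR: "A ** a ** R = R" and S: "S = A - A ** R" and ESa: "E ** S ** a = 0"
    and F: "F = mat 1 - E" and FRa: "F ** R ** a = 0"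
  shows "drazin S = F ** a ** F - (\<Sum>i<ind A. matpow (F ** a) (i + 2) ** E ** S ** matpow A i)
    - (\<Sum>i<ind A. matpow (F ** a) (i + 1) ** F ** R ** matpow A i)"
proof -
  define P where "P = A ** a"
  define G where "G = R ** a"
  define X where "X = F ** a ** F"
  note assoc = matrix_mul_assoc[symmetric]
  have aA: "a ** A = P"
    by (simp add: P_def a_def drazin_commute)
  have PA: "P ** A = A ** P" and Pa: "P ** a = a" and aP: "a ** P = a"
    using drazin_outer[of A] aA unfolding P_def a_def by (metis matrix_mul_assoc)+
  have Ak: "matpow A (ind A) ** P = matpow A (ind A)"
    using matpow_ind_drazin[of A] unfolding P_def a_def by (simp add: matrix_mul_assoc)
  have "P ** P = A ** (a ** P)" by (simp only: P_def matrix_mul_assoc)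
  also have "\<dots> = P" by (simp only: aP) (simp only: P_def)
  finally have PP: "P ** P = P" .
  have PE: "P ** E = E" and EP: "E ** P = E" and PR: "P ** R = R"
    using AaE EAa AaR by (simp_all add: P_def matrix_mul_assoc)
  have FE: "F ** E = 0" "E ** F = 0" "F ** F = F" and PF: "P ** F = P - E" and FP: "F ** P = P - E"
    using EE PE EP by (simp_all add: F matrix_distribs)
  have FG: "F ** G = 0" using FRa by (simp add: G_def matrix_mul_assoc)
  have EG: "E ** G = G" using FG by (simp add: F matrix_distribs)
  have PG: "P ** G = G" using PR by (simp add: G_def matrix_mul_assoc)
  have Sa: "S ** a = P - A ** G"
    by (simp add: S P_def G_def matrix_distribs matrix_mul_assoc)
  have EAG: "E ** A ** G = E"
    using ESa Sa EP by (simp add: assoc matrix_distribs)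
  note GE = corner_inverse[OF EE EG EAG]
  have GF: "G ** F = 0" using GE(1) by (simp add: F matrix_distribs)
  have SP: "S ** P = (P - A ** G) ** A"
    by (metis Sa aA matrix_mul_assoc)
  \<comment> \<open>Uses that \<open>G\<close> is also a left inverse in the corner:
    \<open>G ** A ** E = E\<close> makes the two terms cancel.\<close>
  have SE: "S ** E = 0"
  proof -
    have "S ** E = (P - A ** G) ** A ** E" by (metis SP PE matrix_mul_assoc)
    also have "\<dots> = A ** (P ** E) - A ** (G ** A ** E)"
      by (simp add: matrix_distribs matrix_mul_assoc PA)
    finally show ?thesis by (simp add: PE GE)
  qed
  have ESP: "E ** S ** P = 0"
    by (metis ESa aA matrix_mul_assoc times0_left)
  \<comment> \<open>Both \<open>S ** X\<close> and \<open>X ** S ** P\<close> turn out to be the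
    idempotent \<open>P - E\<close>, the unit of the corner in which \<open>X\<close> inverts
    \<open>S ** P\<close>.\<close>
  have SX: "S ** X = P - E"
  proof -
    have "S ** X = S ** a ** F - S ** E ** (a ** F)"
      by (simp add: X_def F matrix_distribs matrix_mul_assoc)
    also have "\<dots> = P - E" by (simp add: SE Sa matrix_distribs PF assoc GF)
    finally show ?thesis .
  qed
  have XSP: "X ** S ** P = P - E"
  proof -
    have "X ** S ** P = F ** a ** (S ** P) - F ** a ** (E ** S ** P)"
      by (simp add: X_def F matrix_distribs matrix_mul_assoc)
    also have "\<dots> = F ** (a ** P) ** A - F ** (P ** G) ** A"
      by (simp add: ESP SP matrix_distribs matrix_mul_assoc) (simp add: assoc aA)
    also have "\<dots> = P - E"
      by (simp add: aP PG FG) (simp add: assoc aA FP)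
    finally show ?thesis .
  qed
  have PX: "P ** X = X" and XP: "X ** P = X"
  proof -
    have "P ** X = F ** (P ** a) ** F"
      unfolding X_def matrix_mul_assoc PF FP ..
    then show "P ** X = X" by (simp add: Pa X_def)
    have "X ** P = F ** (a ** P) ** F"
      unfolding X_def by (metis PF FP matrix_mul_assoc)
    then show "X ** P = X" by (simp add: aP X_def)
  qed
  have XE: "X ** E = 0" by (simp add: X_def assoc FE)
  have S\<pi>: "(mat 1 - P) ** S = (mat 1 - P) ** A"
  proof -
    have "P ** (A ** R) = A ** R" by (metis PA PR matrix_mul_assoc)
    then show ?thesis by (simp add: S matrix_distribs)
  qed
  have dS: "drazin S = X + (\<Sum>i<ind A. matpow X (i + 2) ** S ** (mat 1 - P) ** matpow A i)"
  proof (rule drazin_block_triangular)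
    show "X ** S ** X = X"
      by (simp add: assoc SX) (simp add: matrix_distribs XP XE)
    show "S ** X ** S ** P = S ** P"
    proof -
      have "P ** (S ** P) = S ** P"
        unfolding SP by (simp add: matrix_distribs matrix_mul_assoc PP PA)
          (simp add: assoc PP PG)
      then show ?thesis using ESP by (simp add: SX matrix_distribs assoc)
    qed
  qed (use PA PP Ak S\<pi> PX XP XSP SX in simp_all)
  have "matpow X (i + 2) ** S ** (mat 1 - P) ** matpow A i
      = - (matpow (F ** a) (i + 2) ** E ** S ** matpow A i)
        - matpow (F ** a) (i + 1) ** F ** R ** matpow A i" for i
  proof -
    have 1: "F ** S ** (mat 1 - P) = S ** (mat 1 - P) - E ** S"
      using ESP by (simp add: F matrix_distribs)
    \<comment> \<open>One factor \<open>F ** a\<close> of the power is used up here, hence exponent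
      i + 1 in the second sum. As a A = P, the part from \<open>A\<close> is F P (1-P) = 0; in the
      part from \<open>A ** R\<close>, the projection disappears because F R P = F R a A =
      0.\<close>
    have 2: "F ** a ** (S ** (mat 1 - P)) = - (F ** R)"
    proof -
      have "F ** R ** P = 0" by (metis FRa aA matrix_mul_assoc times0_left)
      moreover have "F ** a ** A ** R = F ** R"
        by (metis aA PR matrix_mul_assoc)
      moreover have "F ** a ** A ** P = F ** a ** A"
        by (metis aA PP matrix_mul_assoc)
      ultimately show ?thesis by (simp add: S matrix_distribs matrix_mul_assoc)
    qed
    have "matpow X (i + 2) = matpow (F ** a) (i + 2) ** F"
      using matpow_mult_idem[OF FE(3), of a "i + 1"] by (simp add: X_def)
    then have "matpow X (i + 2) ** S ** (mat 1 - P)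
        = matpow (F ** a) (i + 2) ** (F ** S ** (mat 1 - P))"
      by (simp only: matrix_mul_assoc)
    also have "\<dots> = matpow (F ** a) (i + 2) ** (S ** (mat 1 - P))
        - matpow (F ** a) (i + 2) ** (E ** S)"
      unfolding 1 by (rule matrix_sub_ldistrib)
    also have "matpow (F ** a) (i + 2) ** (S ** (mat 1 - P))
        = matpow (F ** a) (i + 1) ** (F ** a ** (S ** (mat 1 - P)))"
    proof -
      have "matpow (F ** a) (i + 2) = matpow (F ** a) (i + 1) ** (F ** a)"
        using matpow_Suc_right[of "F ** a" "i + 1"] by simp
      then show ?thesis by (simp only: matrix_mul_assoc)
    qed
    also have "matpow (F ** a) (i + 1) ** (F ** a ** (S ** (mat 1 - P)))
        = - (matpow (F ** a) (i + 1) ** F ** R)"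
      unfolding 2 matrix_minus_right by (simp only: matrix_mul_assoc)
    finally show ?thesis
      by (simp only: matrix_sub_rdistrib matrix_minus_left matrix_mul_assoc) simp
  qed
  then show ?thesis
    unfolding dS by (simp add: X_def sum_subtractf sum_negf del: matpow.simps)
qed

section \<open>From \<open>K\<close>, \<open>H\<close> and \<open>\<Gamma>\<close> to the idempotent
  \<open>E\<close>\<close>

theorem theorem2p12:
  fixes A S :: "complex^'n^'n"
    and D \<Gamma> :: "complex^'m^'m"
    and B H :: "complex^'n^'m"
    and C K :: "complex^'m^'n"
    and k :: nat
  assumes S: "S = A - C ** drazin D ** B"
    and H: "H = B ** drazin A"
    and K: "K = drazin A ** C"
    and \<Gamma>: "\<Gamma> = H ** K"
    and k: "k = ind A"
    and "spectral_idem A ** C ** drazin D ** B = 0"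
    and "K ** drazin \<Gamma> ** H ** S ** drazin A = 0"
    and "K ** spectral_idem \<Gamma> ** drazin D ** H = 0"
  shows "drazin S =
      (mat 1 - K ** drazin \<Gamma> ** H) ** drazin A ** (mat 1 - K ** drazin \<Gamma> ** H)
      - (\<Sum>i<k. matpow ((mat 1 - K ** drazin \<Gamma> ** H) ** drazin A) (i + 2)
                 ** K ** drazin \<Gamma> ** H ** S ** matpow A i)
      - (\<Sum>i<k. matpow ((mat 1 - K ** drazin \<Gamma> ** H) ** drazin A) (i + 1)
                 ** K ** spectral_idem \<Gamma> ** drazin D ** B ** matpow A i)"
proof -
  define E where "E = K ** drazin \<Gamma> ** H"
  define R where "R = K ** drazin D ** B"
  have aAa: "drazin A ** A ** drazin A = drazin A" "A ** drazin A ** drazin A = drazin A"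
    using drazin_outer[of A] drazin_commute[of A] by simp_all
  have PK: "A ** drazin A ** K = K"
    unfolding K by (simp add: matrix_mul_assoc aAa)
  have HP: "H ** A ** drazin A = H"
    unfolding H by (metis aAa(1) matrix_mul_assoc)
  have "E ** E = K ** (drazin \<Gamma> ** \<Gamma> ** drazin \<Gamma>) ** H"
    by (simp add: E_def \<Gamma> matrix_mul_assoc)
  then have EE: "E ** E = E" by (simp add: drazin_outer E_def)
  have AaE: "A ** drazin A ** E = E" and AaR: "A ** drazin A ** R = R"
    by (simp_all add: E_def R_def matrix_mul_assoc PK)
  have EAa: "E ** A ** drazin A = E"
    unfolding E_def by (metis HP matrix_mul_assoc)
  have SR: "S = A - A ** R"
    using assms(6) by (simp add: S R_def K spectral_idem_def matrix_distribs matrix_mul_assoc)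
  have ESa: "E ** S ** drazin A = 0" using assms(7) by (simp add: E_def)
  \<comment> \<open>Since \<open>H ** K\<close> is \<open>\<Gamma>\<close>, moving \<open>K\<close>
    to the front turns the complement of \<open>E\<close> into the spectral idempotent of
    \<open>\<Gamma>\<close>. This identifies the second sum and the third vanishing
    hypothesis.\<close>
  have FK: "(mat 1 - E) ** K = K ** spectral_idem \<Gamma>"
    using drazin_commute[of \<Gamma>]
    by (simp add: E_def spectral_idem_def matrix_distribs) (simp add: \<Gamma> matrix_mul_assoc)
  have FR: "(mat 1 - E) ** R = K ** spectral_idem \<Gamma> ** drazin D ** B"
    by (simp add: R_def matrix_mul_assoc FK)
  have FRa: "(mat 1 - E) ** R ** drazin A = 0"
    using assms(8) unfolding FR H by (simp add: matrix_mul_assoc)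
  note D = drazin_idem_perturbation[OF EE AaE EAa AaR SR ESa refl FRa]
  have "M ** (mat 1 - E) ** R = M ** K ** spectral_idem \<Gamma> ** drazin D ** B" for M :: "complex^'n^'n"
    using FR by (simp only: matrix_mul_assoc[symmetric])
  then show ?thesis
    unfolding D k by (simp add: E_def matrix_mul_assoc del: matpow.simps)
qed

end
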